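(* Let $U=\{u^j\}_{j=1}^N\subset X$ be a data set in a Hilbert space $X$, let $\{\lambda_i^{DQ1}\}$ and $\{\varphi_i\}$ be the POD eigenvalues and POD modes of the operator $K_1$ defined in the context, and let $s$ be the number of positive singular values of $K_1$. Let $r$ be a positive integer, $X_r=\mathrm{span}\{\varphi_k\}_{k=1}^r$, and let $\Pi_r^X:X\to X$ be the orthogonal projection onto $X_r$. Then $$\|u^1-\Pi_r^X u^1\|_X^2+\sum_{j=1}^{N-1}\Delta t\,\|\partial u^j-\Pi_r^X\partial u^j\|_X^2=\sum_{i=r+1}^s\lambda_i^{DQ1}.$$ If $Y$ is a Hilbert space with $U\subset Y$, then $$\|u^1-\Pi_r^X u^1\|_Y^2+\sum_{j=1}^{N-1}\Delta t\,\|\partial u^j-\Pi_r^X\partial u^j\|_Y^2=\sum_{i=r+1}^s\lambda_i^{DQ1}\|\varphi_i\|_Y^2.$$ If in addition $\pi_r:Y\to Y$ is a bounded linear projection onto $X_r$, then $$\|u^1-\pi_r u^1\|_Y^2+\sum_{j=1}^{N-1}\Delta t\,\|\partial u^j-\pi_r\partial u^j\|_Y^2=\sum_{i=r+1}^s\lambda_i^{DQ1}\|\varphi_i-\pi_r\varphi_i\|_Y^2.$$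
   Context: $X$ and $Y$ are Hilbert spaces over $\mathbb{K}=\mathbb{R}$ or $\mathbb{C}$ (when both appear, they are linear subspaces of a common vector space, so that the linear operations on common elements agree). $N\ge2$ is an integer, $T>0$, $\Delta t=T/(N-1)$, and $\partial u^j=\frac{u^{j+1}-u^j}{\Delta t}$ for $j=1,\dots,N-1$. Let $S=\mathbb{K}^N$ with the weighted inner product $(g,h)_S=\sum_{j=1}^N\gamma_j g^j\overline{h^j}$, where $\gamma_1=1$ and $\gamma_{j}=\Delta t$ for $j=2,\dots,N$. The operator $K_1:S\to X$ is $$K_1 f=f^1u^1+\sum_{j=1}^{N-1}\Delta t\,f^{j+1}\,\partial u^j,\qquad f=[f^1,\dots,f^N]^T.$$ It has a singular value decomposition with singular values $(\lambda_i^{DQ1})^{1/2}$, in nonincreasing order, and orthonormal singular vectors $f_i\in S$, $\varphi_i\in X$, so that $K_1f_i=(\lambda_i^{DQ1})^{1/2}\varphi_i$. The $\varphi_i$ are the POD modes and the $\lambda_i^{DQ1}$ the POD eigenvalues; $r$ is such that the modes $\varphi_1,\dots,\varphi_r$ exist. A bounded linear operator $\Pi$ on a normed space is a projection onto a subspace $Z_r$ if $\Pi^2=\Pi$ and its range is $Z_r$ (it need not be orthogonal). Empty sums are zero. *)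

theory Defs
  imports "HOL-Analysis.Analysis" "Jordan_Normal_Form.Conjugate"
begin

text \<open>
  Scalar fields. The library instances are \<open>real\<close> and \<open>complex\<close>; by the Gelfand--Mazur theorem
  every commutative normed division algebra over the reals is isomorphic to one of these, and
  \<open>mult_conjugate_norm\<close> forces \<open>conjugate\<close> to be the usual conjugation.
\<close>

class real_or_complex_field = real_normed_field + conjugatable_field +
  assumes mult_conjugate_norm: "x * conjugate x = (norm x)\<^sup>2 *\<^sub>R 1"

instance real :: real_or_complex_field
  by standard (simp add: power2_eq_square)

instance complex :: real_or_complex_field
  by standard (simp add: complex_mult_cnj cmod_power2 scaleR_conv_of_real)

definition ip_norm :: "('v \<Rightarrow> 'v \<Rightarrow> 'k::real_normed_vector) \<Rightarrow> 'v \<Rightarrow> real" where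
  "ip_norm ip x = sqrt (norm (ip x x))"

text \<open>
  A Hilbert space is carried by a subspace \<open>H\<close> of an ambient vector space (the type \<open>'v\<close>), so that
  two Hilbert spaces can share elements and linear operations. The values of \<open>ip\<close> are only relevant
  on \<open>H\<close>. Inner products are linear in the first argument.
\<close>

locale hilbert_space = vector_space smul
  for smul :: "'k::real_or_complex_field \<Rightarrow> 'v::ab_group_add \<Rightarrow> 'v" +
  fixes H :: "'v set" and ip :: "'v \<Rightarrow> 'v \<Rightarrow> 'k"
  assumes subspace_H: "subspace H"
    and ip_add: "\<lbrakk>x \<in> H; y \<in> H; z \<in> H\<rbrakk> \<Longrightarrow> ip (x + y) z = ip x z + ip y z"
    and ip_scale: "\<lbrakk>x \<in> H; y \<in> H\<rbrakk> \<Longrightarrow> ip (smul c x) y = c * ip x y"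
    and ip_conjugate: "\<lbrakk>x \<in> H; y \<in> H\<rbrakk> \<Longrightarrow> ip y x = conjugate (ip x y)"
    and ip_nonneg: "x \<in> H \<Longrightarrow> \<exists>c\<ge>0. ip x x = of_real c"
    and ip_definite: "\<lbrakk>x \<in> H; ip x x = 0\<rbrakk> \<Longrightarrow> x = 0"
    and complete: "Metric_space.mcomplete H (\<lambda>x y. ip_norm ip (x - y))"

definition orthonormal_family ::
    "'v set \<Rightarrow> ('v \<Rightarrow> 'v \<Rightarrow> 'k::zero_neq_one) \<Rightarrow> 'i set \<Rightarrow> ('i \<Rightarrow> 'v) \<Rightarrow> bool" where
  "orthonormal_family H ip I v \<longleftrightarrow>
     (\<forall>i\<in>I. v i \<in> H) \<and> (\<forall>i\<in>I. \<forall>j\<in>I. ip (v i) (v j) = (if i = j then 1 else 0))"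

definition orthogonal_projection ::
    "'v::ab_group_add set \<Rightarrow> ('v \<Rightarrow> 'v \<Rightarrow> 'k::zero) \<Rightarrow> 'v set \<Rightarrow> ('v \<Rightarrow> 'v) \<Rightarrow> bool" where
  "orthogonal_projection H ip Z P \<longleftrightarrow>
     Z \<subseteq> H \<and> (\<forall>x\<in>H. P x \<in> Z \<and> (\<forall>z\<in>Z. ip (x - P x) z = 0))"

definition bounded_projection ::
    "('k \<Rightarrow> 'v::ab_group_add \<Rightarrow> 'v) \<Rightarrow> 'v set \<Rightarrow> ('v \<Rightarrow> 'v \<Rightarrow> 'k::real_normed_vector)
       \<Rightarrow> 'v set \<Rightarrow> ('v \<Rightarrow> 'v) \<Rightarrow> bool" where
  "bounded_projection smul H ip Z P \<longleftrightarrow>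
     (\<forall>x\<in>H. P x \<in> H) \<and>
     (\<forall>x\<in>H. \<forall>y\<in>H. P (x + y) = P x + P y) \<and>
     (\<forall>c. \<forall>x\<in>H. P (smul c x) = smul c (P x)) \<and>
     (\<exists>C. \<forall>x\<in>H. ip_norm ip (P x) \<le> C * ip_norm ip x) \<and>
     (\<forall>x\<in>H. P (P x) = P x) \<and>
     P ` H = Z"

text \<open>
  Singular value decomposition of \<open>K : S \<rightarrow> H\<close> with finitely many right singular vectors
  \<open>f 1, \<dots>, f p\<close>. The last clause says that the decomposition is complete. Zero singular values are
  allowed, so both the reduced decomposition and the full one (\<open>f\<close> a basis of \<open>S\<close>) are covered.
  The index set \<open>J\<close> of the left singular vectors \<open>\<phi>\<close> may be larger than \<open>{1..p}\<close>, e.g. if \<open>\<phi>\<close> is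
  an orthonormal basis of \<open>H\<close>; the vectors with index outside \<open>{1..p}\<close> belong to the singular
  value zero.
\<close>

definition is_svd ::
    "('k::real_or_complex_field \<Rightarrow> 'v::ab_group_add \<Rightarrow> 'v)
       \<Rightarrow> 's set \<Rightarrow> ('s \<Rightarrow> 's \<Rightarrow> 'k) \<Rightarrow> 'v set \<Rightarrow> ('v \<Rightarrow> 'v \<Rightarrow> 'k) \<Rightarrow> ('s \<Rightarrow> 'v)
       \<Rightarrow> nat \<Rightarrow> nat set \<Rightarrow> (nat \<Rightarrow> real) \<Rightarrow> (nat \<Rightarrow> 's) \<Rightarrow> (nat \<Rightarrow> 'v) \<Rightarrow> bool" where
  "is_svd smul S ipS H ip K p J \<sigma> f \<phi> \<longleftrightarrow>
     orthonormal_family S ipS {1..p} f \<and>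
     orthonormal_family H ip J \<phi> \<and> {1..p} \<subseteq> J \<and>
     (\<forall>i\<in>{1..p}. 0 \<le> \<sigma> i) \<and>
     (\<forall>i\<in>{1..p}. \<forall>j\<in>{1..p}. i \<le> j \<longrightarrow> \<sigma> j \<le> \<sigma> i) \<and>
     (\<forall>i\<in>{1..p}. K (f i) = smul (of_real (\<sigma> i)) (\<phi> i)) \<and>
     (\<forall>g\<in>S. (\<forall>i\<in>{1..p}. ipS g (f i) = 0) \<longrightarrow> K g = 0)"

text \<open>\<open>\<bbbK>\<^sup>N\<close>, with components indexed by \<open>1, \<dots>, N\<close>.\<close>

definition coeff_space :: "nat \<Rightarrow> (nat \<Rightarrow> 'k::zero) set" where
  "coeff_space N = {g. \<forall>j. j \<notin> {1..N} \<longrightarrow> g j = 0}"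

definition time_step :: "real \<Rightarrow> nat \<Rightarrow> real" where
  "time_step T N = T / (real N - 1)"

definition ip_coeff ::
    "real \<Rightarrow> nat \<Rightarrow> (nat \<Rightarrow> 'k::real_or_complex_field) \<Rightarrow> (nat \<Rightarrow> 'k) \<Rightarrow> 'k" where
  "ip_coeff T N g h =
     (\<Sum>j=1..N. of_real (if j = 1 then 1 else time_step T N) * g j * conjugate (h j))"

definition diff_quot ::
    "('k::real_or_complex_field \<Rightarrow> 'v::ab_group_add \<Rightarrow> 'v) \<Rightarrow> real \<Rightarrow> nat \<Rightarrow> (nat \<Rightarrow> 'v)
       \<Rightarrow> nat \<Rightarrow> 'v" where
  "diff_quot smul T N u j = smul (of_real (1 / time_step T N)) (u (j + 1) - u j)"

definition K1 ::
    "('k::real_or_complex_field \<Rightarrow> 'v::ab_group_add \<Rightarrow> 'v) \<Rightarrow> real \<Rightarrow> nat \<Rightarrow> (nat \<Rightarrow> 'v)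
       \<Rightarrow> (nat \<Rightarrow> 'k) \<Rightarrow> 'v" where
  "K1 smul T N u g =
     smul (g 1) (u 1)
     + (\<Sum>j=1..N-1. smul (of_real (time_step T N) * g (j + 1)) (diff_quot smul T N u j))"

end

theory Submission
  imports Defs
begin

text \<open>
  Put \<open>v 1 = u 1\<close> and \<open>v (j + 1) = \<partial>u j\<close>. The operator \<open>K1\<close> is the weighted sum
  \<open>g \<mapsto> (\<Sum>j. w j * g j * v j)\<close>, with the same weights \<open>w\<close> as the inner product of the coefficient
  space. Hence \<open>v j\<close> is the image of the Riesz representative of the evaluation functional
  \<open>g \<mapsto> g j\<close>. Expanding that representative in the right singular vectors gives
  \<open>v j = (\<Sum>i\<le>s. \<sigma> i * cnj (f i j) * \<phi> i)\<close> (lemma \<open>column_svd_expansion\<close>).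

  This expansion separates the two roles of the data. The index \<open>j\<close> only enters through the
  coefficients \<open>f i j\<close>, which are orthonormal in the weighted inner product over \<open>j\<close>. A residual
  of the form \<open>v j - P (v j) = (\<Sum>i. \<sigma> i * cnj (f i j) * y i)\<close> therefore satisfies the
  Pythagorean identity \<open>(\<Sum>j. w j * \<parallel>v j - P (v j)\<parallel>\<^sup>2) = (\<Sum>i. (\<sigma> i)\<^sup>2 * \<parallel>y i\<parallel>\<^sup>2)\<close> in
  whichever Hilbert space contains the vectors \<open>y i\<close>, whether or not these are orthogonal there
  (lemma \<open>weighted_norm_sum_of_orthonormal_coefficients\<close>).

  All three equations are instances. The orthogonal projection removes the terms \<open>i \<le> r\<close> and leaves
  \<open>y i = \<phi> i\<close>, which are unit vectors in \<open>X\<close>. A bounded projection \<open>\<pi>\<close> of \<open>Y\<close> fixes \<open>\<phi> i\<close> for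
  \<open>i \<le> r\<close>, so \<open>y i = \<phi> i - \<pi> (\<phi> i)\<close> for \<open>i > r\<close>. The modes with positive singular value lie in
  \<open>Y\<close> because they are multiples of \<open>K1 (f i)\<close>, a combination of the data.
\<close>

section \<open>Sesquilinear algebra in a Hilbert space\<close>

context hilbert_space
begin

lemma ip_self: "ip x x = of_real ((ip_norm ip x)\<^sup>2)" if x: "x \<in> H"
proof -
  obtain c where "c \<ge> 0" "ip x x = of_real c"
    using ip_nonneg[OF x] by blast
  then show ?thesis by (simp add: ip_norm_def)
qed

lemma ip_zero_left: "y \<in> H \<Longrightarrow> ip 0 y = 0"
  using ip_scale[of 0 y 0] subspace_H subspace_0 by simp

lemma ip_sum_left:
  assumes "finite I" "\<And>i. i \<in> I \<Longrightarrow> y i \<in> H" "z \<in> H"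
  shows "ip (\<Sum>i\<in>I. y i) z = (\<Sum>i\<in>I. ip (y i) z)"
  using assms
proof (induction I rule: finite_induct)
  case empty
  then show ?case by (simp add: ip_zero_left)
next
  case (insert i I)
  then have "(\<Sum>i\<in>I. y i) \<in> H" by (intro subspace_sum[OF subspace_H]) auto
  with insert show ?case by (simp add: ip_add)
qed

lemma ip_sum_right:
  assumes "finite I" "\<And>i. i \<in> I \<Longrightarrow> y i \<in> H" "z \<in> H"
  shows "ip z (\<Sum>i\<in>I. y i) = (\<Sum>i\<in>I. ip z (y i))"
proof -
  have "(\<Sum>i\<in>I. y i) \<in> H" using assms by (intro subspace_sum[OF subspace_H]) auto
  then have "ip z (\<Sum>i\<in>I. y i) = conjugate (\<Sum>i\<in>I. ip (y i) z)"
    using assms by (simp add: ip_conjugate[of "\<Sum>i\<in>I. y i" z] ip_sum_left)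
  also have "\<dots> = (\<Sum>i\<in>I. conjugate (ip (y i) z))"
    using assms by (simp add: sum_conjugate)
  also have "\<dots> = (\<Sum>i\<in>I. ip z (y i))"
    using assms by (intro sum.cong refl) (simp add: ip_conjugate[of _ z])
  finally show ?thesis .
qed

lemma ip_scale_right:
  assumes "x \<in> H" "y \<in> H"
  shows "ip x (smul c y) = conjugate c * ip x y"
proof -
  have "smul c y \<in> H" using assms subspace_scale[OF subspace_H] by blast
  then have "ip x (smul c y) = conjugate (ip (smul c y) x)"
    using ip_conjugate assms by blast
  also have "\<dots> = conjugate c * ip x y"
    using assms by (simp add: ip_scale conjugate_dist_mul ip_conjugate[of y x])
  finally show ?thesis .
qed

lemma ip_diff_left:
  assumes "x \<in> H" "y \<in> H" "z \<in> H"
  shows "ip (x - y) z = ip x z - ip y z"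
proof -
  have "x - y \<in> H" using assms subspace_diff[OF subspace_H] by blast
  from ip_add[OF this assms(2,3)] show ?thesis by simp
qed

lemma ip_linear_combinations:
  assumes "finite I" "\<And>i. i \<in> I \<Longrightarrow> y i \<in> H"
  shows "ip (\<Sum>i\<in>I. smul (a i) (y i)) (\<Sum>k\<in>I. smul (b k) (y k))
         = (\<Sum>i\<in>I. \<Sum>k\<in>I. a i * conjugate (b k) * ip (y i) (y k))"
proof -
  have sc: "smul c (y i) \<in> H" if "i \<in> I" for i c
    using that assms subspace_scale[OF subspace_H] by blast
  have "(\<Sum>k\<in>I. smul (b k) (y k)) \<in> H"
    using sc by (intro subspace_sum[OF subspace_H]) auto
  then show ?thesis
    using assms sc by (simp add: ip_sum_left ip_sum_right ip_scale ip_scale_right mult_ac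
        cong: sum.cong)
qed

end

lemma conjugate_of_real [simp]:
  "conjugate (of_real c :: 'k::real_or_complex_field) = of_real c"
proof (cases "c = 0")
  case False
  have "of_real c * conjugate (of_real c :: 'k) = of_real c * of_real c"
    using mult_conjugate_norm[of "of_real c :: 'k"] by (simp add: scaleR_conv_of_real power2_eq_square
        flip: of_real_mult)
  with False show ?thesis by simp
qed simp

section \<open>Weighted sums of squared norms\<close>

text \<open>
  When the squared norms are expanded, summing over \<open>j\<close> first turns each cross term
  \<open>ip (y i) (y k)\<close> with \<open>i \<noteq> k\<close> into a multiple of the inner product of \<open>g k\<close> and \<open>g i\<close>, which
  vanishes. The cross terms thus cancel although the vectors \<open>y i\<close> need not be orthogonal.
\<close>

lemma (in hilbert_space) weighted_norm_sum_of_orthonormal_coefficients: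
  fixes w c :: "_ \<Rightarrow> real" and g :: "'i \<Rightarrow> 'j \<Rightarrow> 'k"
  assumes I: "finite I" and y: "\<And>i. i \<in> I \<Longrightarrow> y i \<in> H"
    and orth: "\<And>i k. i \<in> I \<Longrightarrow> k \<in> I \<Longrightarrow>
      (\<Sum>j\<in>A. of_real (w j) * g i j * conjugate (g k j)) = (if i = k then 1 else 0)"
  shows "(\<Sum>j\<in>A. w j * (ip_norm ip (\<Sum>i\<in>I. smul (of_real (c i) * conjugate (g i j)) (y i)))\<^sup>2)
         = (\<Sum>i\<in>I. (c i)\<^sup>2 * (ip_norm ip (y i))\<^sup>2)"
proof -
  define d where "d j = (\<Sum>i\<in>I. smul (of_real (c i) * conjugate (g i j)) (y i))" for j
  have d: "d j \<in> H" for j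
    unfolding d_def using y by (intro subspace_sum[OF subspace_H] subspace_scale[OF subspace_H]) auto
  have "of_real (\<Sum>j\<in>A. w j * (ip_norm ip (d j))\<^sup>2) = (\<Sum>j\<in>A. of_real (w j) * ip (d j) (d j))"
    by (simp add: ip_self[OF d])
  also have "\<dots> = (\<Sum>j\<in>A. \<Sum>i\<in>I. \<Sum>k\<in>I.
      of_real (c i) * of_real (c k) * ip (y i) (y k) * (of_real (w j) * g k j * conjugate (g i j)))"
    unfolding d_def using I y
    by (simp add: ip_linear_combinations conjugate_dist_mul sum_distrib_left mult_ac)
  also have "\<dots> = (\<Sum>i\<in>I. \<Sum>j\<in>A. \<Sum>k\<in>I.
      of_real (c i) * of_real (c k) * ip (y i) (y k) * (of_real (w j) * g k j * conjugate (g i j)))"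
    by (rule sum.swap)
  also have "\<dots> = (\<Sum>i\<in>I. \<Sum>k\<in>I. \<Sum>j\<in>A.
      of_real (c i) * of_real (c k) * ip (y i) (y k) * (of_real (w j) * g k j * conjugate (g i j)))"
    by (intro sum.cong refl sum.swap)
  also have "\<dots> = (\<Sum>i\<in>I. \<Sum>k\<in>I.
      of_real (c i) * of_real (c k) * ip (y i) (y k) * (if k = i then 1 else 0))"
    by (intro sum.cong refl) (simp only: orth flip: sum_distrib_left)
  also have "\<dots> = (\<Sum>i\<in>I. of_real (c i) * of_real (c i) * ip (y i) (y i))"
    using I by (intro sum.cong refl) (simp add: mult_delta_right)
  also have "\<dots> = of_real (\<Sum>i\<in>I. (c i)\<^sup>2 * (ip_norm ip (y i))\<^sup>2)"
    using y by (simp add: ip_self power2_eq_square)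
  finally show ?thesis unfolding d_def of_real_eq_iff .
qed

section \<open>Residuals of projections onto spans\<close>

text \<open>
  The terms with index in \<open>R\<close> form an element \<open>q\<close> of the span, and the remaining terms are
  orthogonal to the span. So \<open>q\<close> has the property that characterizes the value of the projection,
  and \<open>P x - q\<close>, being both in the span and orthogonal to it, is zero.
\<close>

lemma (in hilbert_space) orthogonal_projection_residual:
  assumes on: "orthonormal_family H ip J \<phi>" and P: "orthogonal_projection H ip (span (\<phi> ` R)) P"
    and I: "finite I" "I \<subseteq> J" and R: "R \<subseteq> J"
  shows "(\<Sum>i\<in>I. smul (a i) (\<phi> i)) - P (\<Sum>i\<in>I. smul (a i) (\<phi> i))
         = (\<Sum>i\<in>I - R. smul (a i) (\<phi> i))"
proof -
  define x where "x = (\<Sum>i\<in>I. smul (a i) (\<phi> i))"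
  define q where "q = (\<Sum>i\<in>I \<inter> R. smul (a i) (\<phi> i))"
  define e where "e = (\<Sum>i\<in>I - R. smul (a i) (\<phi> i))"
  have \<phi>: "\<phi> i \<in> H" if "i \<in> J" for i using on that by (auto simp: orthonormal_family_def)
  have x_split: "x = q + e"
    unfolding x_def q_def e_def using I by (simp add: sum.Int_Diff[of I _ R])
  have x: "x \<in> H" and e: "e \<in> H"
    unfolding x_def e_def using I \<phi>
    by (auto intro!: subspace_sum[OF subspace_H] subspace_scale[OF subspace_H])
  have Z: "span (\<phi> ` R) \<subseteq> H"
    using P by (simp add: orthogonal_projection_def)
  have q: "q \<in> span (\<phi> ` R)"
    unfolding q_def by (intro span_sum span_scale span_base) auto
  have e_gen: "ip e (\<phi> k) = 0" if "k \<in> R" for k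
  proof -
    have k: "k \<in> J" using that R by blast
    have "ip e (\<phi> k) = (\<Sum>i\<in>I - R. ip (smul (a i) (\<phi> i)) (\<phi> k))"
      unfolding e_def using I k \<phi> by (intro ip_sum_left) (auto intro!: subspace_scale[OF subspace_H])
    also have "\<dots> = 0"
    proof (rule sum.neutral, rule ballI)
      fix i assume i: "i \<in> I - R"
      then have "i \<in> J" "i \<noteq> k" using that I by auto
      then show "ip (smul (a i) (\<phi> i)) (\<phi> k) = 0"
        using on k \<phi> by (simp add: ip_scale orthonormal_family_def)
    qed
    finally show ?thesis .
  qed
  have e_orth: "ip e z = 0" if "z \<in> span (\<phi> ` R)" for z
  proof -
    have "z \<in> H \<and> ip z e = 0"
      using that
    proof (induction rule: span_induct_alt)
      case base
      then show ?case using e subspace_0[OF subspace_H] by (simp add: ip_zero_left)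
    next
      case (step c b z)
      have b: "b \<in> H" "ip b e = 0"
        using step(1) e e_gen \<phi> R by (auto simp: ip_conjugate[of e])
      then have "smul c b \<in> H" using subspace_scale[OF subspace_H] by blast
      with step(2) b e show ?case
        by (simp add: ip_add ip_scale subspace_add[OF subspace_H])
    qed
    then show ?thesis using ip_conjugate[of z e] e by simp
  qed
  have Px: "P x \<in> span (\<phi> ` R)" and orth: "\<And>z. z \<in> span (\<phi> ` R) \<Longrightarrow> ip (x - P x) z = 0"
    using P x by (auto simp: orthogonal_projection_def)
  have "ip (P x - q) z = 0" if z: "z \<in> span (\<phi> ` R)" for z
  proof -
    have "P x \<in> H" "z \<in> H" using Px z Z by auto
    moreover have "x - P x \<in> H" using x \<open>P x \<in> H\<close> subspace_diff[OF subspace_H] by blast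
    ultimately have "ip (e - (x - P x)) z = 0"
      using e by (simp only: ip_diff_left e_orth[OF z] orth[OF z] diff_self)
    moreover have "P x - q = e - (x - P x)" by (simp add: x_split)
    ultimately show ?thesis by (simp only:)
  qed
  moreover have "P x - q \<in> span (\<phi> ` R)" using Px q by (rule span_diff)
  ultimately have "P x - q = 0" using ip_definite Z by blast
  then have "x - P x = e" by (simp add: x_split)
  then show ?thesis by (simp add: x_def e_def)
qed

lemma (in hilbert_space) bounded_projection_linear_combination:
  assumes P: "bounded_projection smul H ip Z P" and "finite I" "\<And>i. i \<in> I \<Longrightarrow> y i \<in> H"
  shows "P (\<Sum>i\<in>I. smul (a i) (y i)) = (\<Sum>i\<in>I. smul (a i) (P (y i)))"
  using assms(2,3)
proof (induction I rule: finite_induct)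
  case empty
  have "P (smul 0 0) = smul 0 (P 0)"
    using P subspace_0[OF subspace_H] unfolding bounded_projection_def by blast
  then show ?case by simp
next
  case (insert i I)
  have "(\<Sum>i\<in>I. smul (a i) (y i)) \<in> H" and "smul (a i) (y i) \<in> H"
    using insert.prems by (auto intro!: subspace_sum[OF subspace_H] subspace_scale[OF subspace_H])
  moreover have "P (smul (a i) (y i)) = smul (a i) (P (y i))"
    using P insert.prems unfolding bounded_projection_def by blast
  ultimately show ?case
    using insert P unfolding bounded_projection_def by simp
qed

text \<open>
  A projection fixes its range, so the terms with index in \<open>R\<close> contribute \<open>\<phi> i - P (\<phi> i) = 0\<close>.
\<close>

lemma (in hilbert_space) bounded_projection_residual:
  assumes P: "bounded_projection smul H ip (span (\<phi> ` R)) P"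
    and I: "finite I" and \<phi>: "\<And>i. i \<in> I \<Longrightarrow> \<phi> i \<in> H"
  shows "(\<Sum>i\<in>I. smul (a i) (\<phi> i)) - P (\<Sum>i\<in>I. smul (a i) (\<phi> i))
         = (\<Sum>i\<in>I - R. smul (a i) (\<phi> i - P (\<phi> i)))"
proof -
  have "P (\<phi> i) = \<phi> i" if "i \<in> R" for i
  proof -
    have "\<phi> i \<in> P ` H"
      using that P by (simp add: bounded_projection_def span_base)
    then obtain x where "x \<in> H" "\<phi> i = P x" by blast
    then show ?thesis using P by (simp add: bounded_projection_def)
  qed
  then have "(\<Sum>i\<in>I - R. smul (a i) (\<phi> i - P (\<phi> i))) = (\<Sum>i\<in>I. smul (a i) (\<phi> i - P (\<phi> i)))"
    using I by (intro sum.mono_neutral_left) auto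
  then show ?thesis
    using bounded_projection_linear_combination[OF P I \<phi>]
    by (simp add: scale_right_diff_distrib sum_subtractf)
qed

section \<open>The data as weighted columns of the operator\<close>

text \<open>
  Indexing the initial value and the difference quotients together by \<open>{1..N}\<close>, with the weights
  of \<open>ip_coeff\<close>, makes \<open>K1\<close> a single weighted sum of columns.
\<close>

definition weight :: "real \<Rightarrow> nat \<Rightarrow> nat \<Rightarrow> real" where
  "weight T N j = (if j = 1 then 1 else time_step T N)"

definition column ::
    "('k::real_or_complex_field \<Rightarrow> 'v::ab_group_add \<Rightarrow> 'v) \<Rightarrow> real \<Rightarrow> nat \<Rightarrow> (nat \<Rightarrow> 'v)
       \<Rightarrow> nat \<Rightarrow> 'v" where
  "column smul T N u j = (if j = 1 then u 1 else diff_quot smul T N u (j - 1))"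

lemma weight_pos: "N \<ge> 2 \<Longrightarrow> T > 0 \<Longrightarrow> weight T N j > 0"
  by (simp add: weight_def time_step_def)

lemma sum_columns:
  fixes h :: "nat \<Rightarrow> 'a::comm_monoid_add"
  assumes "N \<ge> 1"
  shows "(\<Sum>j=1..N. h j) = h 1 + (\<Sum>j=1..N-1. h (j + 1))"
proof -
  obtain M where "N = Suc M" using assms by (cases N) auto
  then show ?thesis
    using sum.atLeast_Suc_atMost[of 1 "Suc M" h] sum.shift_bounds_cl_Suc_ivl[of h 1 M]
    by (simp del: sum.cl_ivl_Suc)
qed

lemma K1_eq_sum_columns:
  assumes "N \<ge> 1"
  shows "K1 smul T N u g = (\<Sum>j=1..N. smul (of_real (weight T N j) * g j) (column smul T N u j))"
  unfolding sum_columns[OF assms] by (auto simp: K1_def weight_def column_def intro!: sum.cong)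

lemma ip_coeff_eq_weight:
  "ip_coeff T N g h = (\<Sum>j=1..N. of_real (weight T N j) * g j * conjugate (h j))"
  by (simp add: ip_coeff_def weight_def)

text \<open>
  The vector \<open>e\<close> represents evaluation at \<open>j\<close>, and \<open>K1\<close> sends it to the \<open>j\<close>-th column. Its
  Fourier coefficients with respect to \<open>f\<close> are \<open>conjugate (f i j)\<close>. Subtracting the Fourier sum
  leaves \<open>g\<close>, which is orthogonal to all \<open>f i\<close> and hence in the kernel of \<open>K1\<close> by completeness of
  the singular value decomposition.
\<close>

lemma (in hilbert_space) column_svd_expansion:
  assumes N: "N \<ge> 2" and T: "T > 0"
    and svd: "is_svd smul (coeff_space N) (ip_coeff T N) H ip (K1 smul T N u) p J \<sigma> f \<phi>"
    and j: "j \<in> {1..N}"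
  shows "column smul T N u j = (\<Sum>i=1..p. smul (of_real (\<sigma> i) * conjugate (f i j)) (\<phi> i))"
proof -
  let ?w = "weight T N" and ?v = "column smul T N u" and ?K = "K1 smul T N u"
  define e :: "nat \<Rightarrow> 'k" where "e k = (if k = j then of_real (1 / ?w j) else 0)" for k
  define g where "g k = e k - (\<Sum>i=1..p. conjugate (f i j) * f i k)" for k
  have wj: "?w j \<noteq> 0" using weight_pos[OF N T, of j] by simp
  have fS: "f i \<in> coeff_space N" if "i \<in> {1..p}" for i
    using svd that by (auto simp: is_svd_def orthonormal_family_def)
  have forth: "ip_coeff T N (f i) (f k) = (if i = k then 1 else 0)"
    if "i \<in> {1..p}" "k \<in> {1..p}" for i k
    using svd that by (auto simp: is_svd_def orthonormal_family_def)
  have Kf: "?K (f i) = smul (of_real (\<sigma> i)) (\<phi> i)" if "i \<in> {1..p}" for i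
    using svd that by (auto simp: is_svd_def)
  have K: "?K h = (\<Sum>k=1..N. smul (of_real (?w k) * h k) (?v k))" for h
    using N by (simp add: K1_eq_sum_columns)

  have gS: "g \<in> coeff_space N"
    using fS j by (auto simp: coeff_space_def g_def e_def)
  have ip_e: "ip_coeff T N e h = conjugate (h j)" for h
  proof -
    have "ip_coeff T N e h = (\<Sum>k=1..N. if k = j then conjugate (h j) else 0)"
      unfolding ip_coeff_eq_weight using wj by (intro sum.cong refl) (simp add: e_def)
    then show ?thesis using j by simp
  qed
  have Ke: "?K e = ?v j"
  proof -
    have "?K e = (\<Sum>k=1..N. if k = j then ?v j else 0)"
      unfolding K using wj by (intro sum.cong refl) (simp add: e_def)
    then show ?thesis using j by simp
  qed
  have ip_g: "ip_coeff T N g h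
      = ip_coeff T N e h - (\<Sum>i=1..p. conjugate (f i j) * ip_coeff T N (f i) h)" for h
  proof -
    have "(\<Sum>i=1..p. conjugate (f i j) * ip_coeff T N (f i) h)
      = (\<Sum>k=1..N. \<Sum>i=1..p. of_real (?w k) * (conjugate (f i j) * f i k) * conjugate (h k))"
      unfolding ip_coeff_eq_weight sum_distrib_left by (subst sum.swap) (simp add: mult_ac)
    then show ?thesis
      by (simp add: ip_coeff_eq_weight g_def algebra_simps sum_subtractf sum_distrib_left
          sum_distrib_right)
  qed
  have Kg: "?K g = ?K e - (\<Sum>i=1..p. smul (conjugate (f i j)) (?K (f i)))"
  proof -
    have "(\<Sum>i=1..p. smul (conjugate (f i j)) (?K (f i)))
      = (\<Sum>k=1..N. \<Sum>i=1..p. smul (of_real (?w k) * (conjugate (f i j) * f i k)) (?v k))"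
      unfolding K scale_sum_right by (subst sum.swap) (simp add: mult_ac)
    then show ?thesis
      by (simp add: K g_def right_diff_distrib scale_left_diff_distrib sum_subtractf
          sum_distrib_left flip: scale_sum_left)
  qed
  have "ip_coeff T N g (f k) = 0" if k: "k \<in> {1..p}" for k
  proof -
    have "(\<Sum>i=1..p. conjugate (f i j) * ip_coeff T N (f i) (f k))
        = (\<Sum>i=1..p. if i = k then conjugate (f k j) else 0)"
      using forth k by (intro sum.cong refl) simp
    then show ?thesis using k by (simp add: ip_g ip_e)
  qed
  then have "?K g = 0" using svd gS by (simp add: is_svd_def)
  then have "?v j = (\<Sum>i=1..p. smul (conjugate (f i j)) (?K (f i)))"
    by (simp add: Kg Ke)
  also have "\<dots> = (\<Sum>i=1..p. smul (of_real (\<sigma> i) * conjugate (f i j)) (\<phi> i))"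
    using Kf by (intro sum.cong refl) (simp add: mult_ac)
  finally show ?thesis .
qed

section \<open>Projection errors of the data\<close>

text \<open>
  Monotonicity makes the indices of the positive singular values an initial segment, so their
  number \<open>s\<close> is also the last such index.
\<close>

lemma positive_prefix:
  fixes \<sigma> :: "nat \<Rightarrow> real"
  assumes "\<forall>i\<in>{1..p}. \<forall>j\<in>{1..p}. i \<le> j \<longrightarrow> \<sigma> j \<le> \<sigma> i"
  shows "{i \<in> {1..p}. \<sigma> i > 0} = {1..card {i \<in> {1..p}. \<sigma> i > 0}}"
proof -
  let ?A = "{i \<in> {1..p}. \<sigma> i > 0}"
  have "?A = {1..Max (insert 0 ?A)}"
  proof (cases "?A = {}")
    case False
    then have M: "Max (insert 0 ?A) = Max ?A" and "Max ?A \<in> ?A"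
      by (simp_all add: Max_insert Max_in del: mem_Collect_eq)
    show ?thesis
    proof
      show "?A \<subseteq> {1..Max (insert 0 ?A)}" unfolding M by auto
      show "{1..Max (insert 0 ?A)} \<subseteq> ?A" unfolding M using \<open>Max ?A \<in> ?A\<close> assms
        by (fastforce intro: less_le_trans)
    qed
  next
    case True
    show ?thesis unfolding True by simp
  qed
  then show ?thesis by (metis card_atLeastAtMost diff_Suc_1)
qed

theorem lemma3p2:
  fixes smul :: "'k::real_or_complex_field \<Rightarrow> 'v::ab_group_add \<Rightarrow> 'v"
    and X :: "'v set" and ipX :: "'v \<Rightarrow> 'v \<Rightarrow> 'k"
    and N p s r :: nat and T :: real
    and u :: "nat \<Rightarrow> 'v"
    and J :: "nat set" and lam :: "nat \<Rightarrow> real"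
    and f :: "nat \<Rightarrow> nat \<Rightarrow> 'k" and \<phi> :: "nat \<Rightarrow> 'v"
    and Xr :: "'v set" and PiX :: "'v \<Rightarrow> 'v"
  assumes "hilbert_space smul X ipX"
    and "N \<ge> 2" and "T > 0"
    and "\<forall>j\<in>{1..N}. u j \<in> X"
    and "is_svd smul (coeff_space N) (ip_coeff T N) X ipX (K1 smul T N u)
           p J (\<lambda>i. sqrt (lam i)) f \<phi>"
    and "s = card {i \<in> {1..p}. sqrt (lam i) > 0}"
    and "r \<ge> 1" and "{1..r} \<subseteq> J"
    and "Xr = module.span smul (\<phi> ` {1..r})"
    and "orthogonal_projection X ipX Xr PiX"
  shows "(ip_norm ipX (u 1 - PiX (u 1)))\<^sup>2
           + (\<Sum>j=1..N-1. time_step T N *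
               (ip_norm ipX (diff_quot smul T N u j - PiX (diff_quot smul T N u j)))\<^sup>2)
         = (\<Sum>i=r+1..s. lam i)
       \<and> (\<forall>Y ipY. hilbert_space smul Y ipY \<and> (\<forall>j\<in>{1..N}. u j \<in> Y) \<longrightarrow>
            (ip_norm ipY (u 1 - PiX (u 1)))\<^sup>2
              + (\<Sum>j=1..N-1. time_step T N *
                  (ip_norm ipY (diff_quot smul T N u j - PiX (diff_quot smul T N u j)))\<^sup>2)
            = (\<Sum>i=r+1..s. lam i * (ip_norm ipY (\<phi> i))\<^sup>2)
          \<and> (\<forall>\<pi>. bounded_projection smul Y ipY Xr \<pi> \<longrightarrow>
               (ip_norm ipY (u 1 - \<pi> (u 1)))\<^sup>2
                 + (\<Sum>j=1..N-1. time_step T N *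
                     (ip_norm ipY (diff_quot smul T N u j - \<pi> (diff_quot smul T N u j)))\<^sup>2)
               = (\<Sum>i=r+1..s. lam i * (ip_norm ipY (\<phi> i - \<pi> (\<phi> i)))\<^sup>2)))"
proof -
  interpret X: hilbert_space smul X ipX by fact
  let ?w = "weight T N" and ?v = "column smul T N u"
  have N1: "N \<ge> 1" and N: "N \<ge> 2" and T: "T > 0" using assms by auto
  note svd = assms(5)
  define c where "c i = sqrt (lam i)" for i
  have c_nonneg: "c i \<ge> 0" if "i \<in> {1..p}" for i
    using svd that by (auto simp: is_svd_def c_def)
  have pos: "{i \<in> {1..p}. c i > 0} = {1..s}"
    using positive_prefix[of p c] svd unfolding assms(6) by (simp add: is_svd_def c_def)
  have s_pos: "i \<in> {1..p} \<and> c i > 0" if "i \<in> {1..s}" for i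
    using that pos by blast
  have on: "orthonormal_family X ipX J \<phi>" and pJ: "{1..p} \<subseteq> J"
    using svd by (auto simp: is_svd_def)
  have sJ: "{1..s} \<subseteq> J" using s_pos pJ by blast
  have c2: "(c i)\<^sup>2 = lam i" if "i \<in> {1..s}" for i
    using s_pos[OF that] by (simp add: c_def)
  have v: "?v j = (\<Sum>i=1..s. smul (of_real (c i) * conjugate (f i j)) (\<phi> i))" if "j \<in> {1..N}" for j
  proof -
    have "c i = 0" if "i \<in> {1..p} - {1..s}" for i
      using that c_nonneg[of i] pos by force
    then have "(\<Sum>i=1..p. smul (of_real (c i) * conjugate (f i j)) (\<phi> i))
        = (\<Sum>i=1..s. smul (of_real (c i) * conjugate (f i j)) (\<phi> i))"
      using s_pos by (intro sum.mono_neutral_right) auto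
    then show ?thesis
      using X.column_svd_expansion[OF N T svd that] by (simp add: c_def)
  qed
  have forth: "(\<Sum>j=1..N. of_real (?w j) * f i j * conjugate (f k j)) = (if i = k then 1 else 0)"
    if "i \<in> {1..s}" "k \<in> {1..s}" for i k
    using svd s_pos that unfolding ip_coeff_eq_weight[symmetric]
    by (auto simp: is_svd_def orthonormal_family_def)

  have tail: "{1..s} - {1..r} = {r+1..s}" by auto
  have PiX: "?v j - PiX (?v j) = (\<Sum>i=r+1..s. smul (of_real (c i) * conjugate (f i j)) (\<phi> i))"
    if "j \<in> {1..N}" for j
    using X.orthogonal_projection_residual[OF on, of "{1..r}" PiX "{1..s}"]
      assms(8-10) sJ that tail by (simp add: v)
  \<comment> \<open>The common core of the three equations: the norm, the projection and the residual directions
    \<open>y\<close> vary, while the coefficients of the residuals stay the same.\<close>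
  have energy: "(ip_norm ip (u 1 - Q (u 1)))\<^sup>2 + (\<Sum>j=1..N-1. time_step T N *
        (ip_norm ip (diff_quot smul T N u j - Q (diff_quot smul T N u j)))\<^sup>2)
      = (\<Sum>i=r+1..s. lam i * (ip_norm ip (y i))\<^sup>2)"
    if "hilbert_space smul H ip" and "\<And>i. i \<in> {1..s} \<Longrightarrow> y i \<in> H"
      and res: "\<And>j. j \<in> {1..N} \<Longrightarrow>
        ?v j - Q (?v j) = (\<Sum>i=r+1..s. smul (of_real (c i) * conjugate (f i j)) (y i))"
    for H ip Q y
  proof -
    interpret hilbert_space smul H ip by fact
    have "(ip_norm ip (u 1 - Q (u 1)))\<^sup>2 + (\<Sum>j=1..N-1. time_step T N *
        (ip_norm ip (diff_quot smul T N u j - Q (diff_quot smul T N u j)))\<^sup>2)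
      = (\<Sum>j=1..N. ?w j * (ip_norm ip (?v j - Q (?v j)))\<^sup>2)"
      unfolding sum_columns[OF N1] by (auto simp: weight_def column_def intro!: sum.cong)
    also have "\<dots> = (\<Sum>j=1..N. ?w j *
        (ip_norm ip (\<Sum>i=r+1..s. smul (of_real (c i) * conjugate (f i j)) (y i)))\<^sup>2)"
      by (intro sum.cong refl) (simp only: res)
    also have "\<dots> = (\<Sum>i=r+1..s. (c i)\<^sup>2 * (ip_norm ip (y i))\<^sup>2)"
      using that(2) forth by (intro weighted_norm_sum_of_orthonormal_coefficients) auto
    also have "\<dots> = (\<Sum>i=r+1..s. lam i * (ip_norm ip (y i))\<^sup>2)"
      by (intro sum.cong refl) (simp add: c2)
    finally show ?thesis .
  qed

  have \<phi>X: "\<phi> i \<in> X" and \<phi>_norm: "ip_norm ipX (\<phi> i) = 1" if "i \<in> {1..s}" for i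
    using on sJ that by (auto simp: orthonormal_family_def ip_norm_def)
  have "(ip_norm ipX (u 1 - PiX (u 1)))\<^sup>2 + (\<Sum>j=1..N-1. time_step T N *
          (ip_norm ipX (diff_quot smul T N u j - PiX (diff_quot smul T N u j)))\<^sup>2)
        = (\<Sum>i=r+1..s. lam i)"
    using energy[OF assms(1) \<phi>X PiX] \<phi>_norm by simp
  moreover have "(ip_norm ipY (u 1 - PiX (u 1)))\<^sup>2 + (\<Sum>j=1..N-1. time_step T N *
          (ip_norm ipY (diff_quot smul T N u j - PiX (diff_quot smul T N u j)))\<^sup>2)
        = (\<Sum>i=r+1..s. lam i * (ip_norm ipY (\<phi> i))\<^sup>2)" (is ?orthogonal)
    and "bounded_projection smul Y ipY Xr \<pi> \<Longrightarrow>
        (ip_norm ipY (u 1 - \<pi> (u 1)))\<^sup>2 + (\<Sum>j=1..N-1. time_step T N *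
          (ip_norm ipY (diff_quot smul T N u j - \<pi> (diff_quot smul T N u j)))\<^sup>2)
        = (\<Sum>i=r+1..s. lam i * (ip_norm ipY (\<phi> i - \<pi> (\<phi> i)))\<^sup>2)" (is "?bdd \<Longrightarrow> ?oblique")
    if Y: "hilbert_space smul Y ipY" and uY: "\<forall>j\<in>{1..N}. u j \<in> Y" for Y ipY \<pi>
  proof -
    interpret Y: hilbert_space smul Y ipY by fact
    have vY: "?v j \<in> Y" if j: "j \<in> {1..N}" for j
    proof -
      have "u (j - 1) \<in> Y" if "j \<noteq> 1"
        using that j by (intro uY[rule_format]) auto
      then show ?thesis using j uY unfolding column_def diff_quot_def
        by (auto intro!: X.subspace_scale[OF Y.subspace_H] X.subspace_diff[OF Y.subspace_H])
    qed
    have \<phi>Y: "\<phi> i \<in> Y" if i: "i \<in> {1..s}" for i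
    proof -
      have "smul (of_real (c i)) (\<phi> i) = K1 smul T N u (f i)"
        using svd s_pos[OF i] by (auto simp: is_svd_def c_def)
      also have "\<dots> \<in> Y"
        unfolding K1_eq_sum_columns[OF N1] using vY
        by (intro X.subspace_sum[OF Y.subspace_H] X.subspace_scale[OF Y.subspace_H])
      finally have "smul (inverse (of_real (c i))) (smul (of_real (c i)) (\<phi> i)) \<in> Y"
        by (rule X.subspace_scale[OF Y.subspace_H])
      then show ?thesis using s_pos[OF i] by simp
    qed
    show ?orthogonal by (rule energy[OF Y \<phi>Y PiX])
    show ?oblique if \<pi>: ?bdd
    proof (rule energy[OF Y])
      show "\<phi> i - \<pi> (\<phi> i) \<in> Y" if "i \<in> {1..s}" for i
        using \<phi>Y[OF that] \<pi>
        by (auto intro!: X.subspace_diff[OF Y.subspace_H] simp: bounded_projection_def)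
      show "?v j - \<pi> (?v j) = (\<Sum>i=r+1..s. smul (of_real (c i) * conjugate (f i j)) (\<phi> i - \<pi> (\<phi> i)))"
        if "j \<in> {1..N}" for j
        using Y.bounded_projection_residual[of \<phi> "{1..r}" \<pi> "{1..s}"] \<pi> \<phi>Y that tail
        by (simp add: v assms(9))
    qed
  qed
  ultimately show ?thesis by blast
qed

end
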